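(* Let $t_0>0$, $\alpha\ge2$, $\beta>0$ and consider the dynamical system (APDMD) $$\begin{cases}\dot x(t)=\frac{\alpha}{t}\left(\nabla\psi^*(u(t))-x(t)\right),\\ \dot u(t)=-\frac{t}{\alpha}\left(\nabla f(x(t))+\beta A^T(Ax(t)-b)+A^Tv(t)\right),\\ \dot\lambda(t)=\frac{\alpha}{t}\left(v(t)-\lambda(t)\right),\\ \dot v(t)=\frac{t}{\alpha}\left(A\nabla\psi^*(u(t))-b\right),\end{cases}$$ with initial values satisfying $\nabla\psi^*(u(t_0))=x(t_0)$. For any such initial values $(x(t_0),u(t_0),\lambda(t_0),v(t_0))\in\mathcal X\times\mathbb R^n\times\mathbb R^m\times\mathbb R^m$, the solution satisfies $x(t)\in\mathcal X$ for all $t\ge t_0>0$, i.e. the solution $x(t)$ is feasible for the set constraint.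
   Context: $\mathcal X\subset\mathbb R^n$ is a closed and convex set, $A\in\mathbb R^{m\times n}$, $b\in\mathbb R^m$. Standing assumptions: $f$ is smooth and convex on an open set containing $\mathcal X$; $\psi:\mathcal X\to\mathbb R$ is proper, essentially strictly convex and cofinite; there exists $x\in\mathrm{int}(\mathcal X)$ with $Ax=b$; the problem $\min f(x)$ s.t. $Ax=b$, $x\in\mathcal X$ has a nonempty solution set. $\psi^*(u)=\sup_{x\in\mathcal X}\{u^Tx-\psi(x)\}$ is the conjugate of $\psi$. A convex function is cofinite if its epigraph contains no non-vertical half-line; it is essentially strictly convex if it is strictly convex and subdifferentiable on all convex subsets (of its domain). Under these hypotheses $\psi^*$ is finite and differentiable and $\nabla\psi^*$ takes values in $\mathcal X$. *)

theory Defs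
  imports "HOL-Analysis.Analysis"
begin

text \<open>
  A function \<open>\<psi> : X \<rightarrow> \<real>\<close> is represented by a total function together with its domain \<open>X\<close>; values
  outside \<open>X\<close> are never used, which amounts to the convention \<open>\<psi> = +\<infinity>\<close> off \<open>X\<close>.
\<close>

definition gradient :: "('a::real_inner \<Rightarrow> real) \<Rightarrow> 'a \<Rightarrow> 'a" where
  "gradient g x = (THE D. GDERIV g x :> D)"

lemma gradient_eq:
  assumes "GDERIV g x :> D"
  shows "gradient g x = D"
  unfolding gradient_def
proof (rule the_equality)
  fix E assume "GDERIV g x :> E"
  then have "(\<lambda>h. inner h E) = (\<lambda>h. inner h D)"
    using assms unfolding gderiv_def by (rule has_derivative_unique)
  then have "inner (E - D) E = inner (E - D) D" by (rule fun_cong)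
  then have "inner (E - D) (E - D) = 0" by (simp add: inner_diff_right)
  then show "E = D" by simp
qed (rule assms)

text \<open>
  ``Smooth'' means continuously differentiable. Since \<^const>\<open>convex_on\<close> includes convexity of the
  domain, the open set \<open>U\<close> is convex.
\<close>

definition smooth_convex_near :: "('a::real_inner) set \<Rightarrow> ('a \<Rightarrow> real) \<Rightarrow> bool" where
  "smooth_convex_near X f \<longleftrightarrow>
     (\<exists>U. open U \<and> X \<subseteq> U \<and> convex_on U f \<and> f differentiable_on U \<and> continuous_on U (gradient f))"

text \<open>As \<open>\<psi>\<close> is real valued on \<open>X\<close>, it cannot take the value \<open>-\<infinity>\<close>.\<close>

definition proper_on :: "'a set \<Rightarrow> ('a \<Rightarrow> real) \<Rightarrow> bool" where
  "proper_on X \<psi> \<longleftrightarrow> epigraph X \<psi> \<noteq> {}"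

definition strictly_convex_on :: "('a::real_vector) set \<Rightarrow> ('a \<Rightarrow> real) \<Rightarrow> bool" where
  "strictly_convex_on C \<psi> \<longleftrightarrow> convex C \<and>
     (\<forall>x\<in>C. \<forall>y\<in>C. \<forall>s>0. \<forall>t>0. x \<noteq> y \<and> s + t = 1 \<longrightarrow>
        \<psi> (s *\<^sub>R x + t *\<^sub>R y) < s * \<psi> x + t * \<psi> y)"

definition subdifferential :: "('a::real_inner) set \<Rightarrow> ('a \<Rightarrow> real) \<Rightarrow> 'a \<Rightarrow> 'a set" where
  "subdifferential X \<psi> x = {g. \<forall>y\<in>X. \<psi> y \<ge> \<psi> x + inner g (y - x)}"

text \<open>
  Strict convexity and subdifferentiability are both required on every convex subset of \<open>X\<close>. This is
  more demanding than Rockafellar's notion, which only asks for strict convexity on the convex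
  subsets of the set where the subdifferential is nonempty.
\<close>

definition essentially_strictly_convex :: "('a::real_inner) set \<Rightarrow> ('a \<Rightarrow> real) \<Rightarrow> bool" where
  "essentially_strictly_convex X \<psi> \<longleftrightarrow> convex_on X \<psi> \<and>
     (\<forall>C. C \<subseteq> X \<and> convex C \<longrightarrow>
        strictly_convex_on C \<psi> \<and> (\<forall>x\<in>C. subdifferential X \<psi> x \<noteq> {}))"

text \<open>A half-line with direction \<open>d\<close> is non-vertical when the first component of \<open>d\<close> is nonzero.\<close>

definition cofinite_on :: "('a::real_vector) set \<Rightarrow> ('a \<Rightarrow> real) \<Rightarrow> bool" where
  "cofinite_on X \<psi> \<longleftrightarrow> convex_on X \<psi> \<and>
     \<not> (\<exists>p d. fst d \<noteq> 0 \<and> (\<forall>s\<ge>0. p + s *\<^sub>R d \<in> epigraph X \<psi>))"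

definition conjugate :: "('a::real_inner) set \<Rightarrow> ('a \<Rightarrow> real) \<Rightarrow> 'a \<Rightarrow> ereal" where
  "conjugate X \<psi> u = (SUP x\<in>X. ereal (inner u x - \<psi> x))"

text \<open>\<open>\<nabla>\<psi>\<^sup>*\<close>; the coercion to the reals is harmless where the conjugate is finite.\<close>

definition grad_conjugate :: "('a::real_inner) set \<Rightarrow> ('a \<Rightarrow> real) \<Rightarrow> 'a \<Rightarrow> 'a" where
  "grad_conjugate X \<psi> = gradient (\<lambda>u. real_of_ereal (conjugate X \<psi> u))"

definition APDMD_solution ::
  "(real^'n) set \<Rightarrow> real^'n^'m \<Rightarrow> real^'m \<Rightarrow> (real^'n \<Rightarrow> real) \<Rightarrow> (real^'n \<Rightarrow> real) \<Rightarrow>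
   real \<Rightarrow> real \<Rightarrow> real \<Rightarrow>
   (real \<Rightarrow> real^'n) \<Rightarrow> (real \<Rightarrow> real^'n) \<Rightarrow> (real \<Rightarrow> real^'m) \<Rightarrow> (real \<Rightarrow> real^'m) \<Rightarrow> bool" where
  "APDMD_solution X A b f \<psi> t0 \<alpha> \<beta> x u l v \<longleftrightarrow>
     (\<forall>t\<ge>t0.
        (x has_vector_derivative (\<alpha> / t) *\<^sub>R (grad_conjugate X \<psi> (u t) - x t)) (at t within {t0..}) \<and>
        (u has_vector_derivative
           - (t / \<alpha>) *\<^sub>R (gradient f (x t) + \<beta> *\<^sub>R (transpose A *v (A *v x t - b)) + transpose A *v v t))
           (at t within {t0..}) \<and>
        (l has_vector_derivative (\<alpha> / t) *\<^sub>R (v t - l t)) (at t within {t0..}) \<and>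
        (v has_vector_derivative (t / \<alpha>) *\<^sub>R (A *v grad_conjugate X \<psi> (u t) - b)) (at t within {t0..}))"

end

theory Submission
  imports Defs
begin

text \<open>
  The first equation of the system pulls \<open>x(t)\<close> towards \<open>\<nabla>\<psi>\<^sup>*(u(t))\<close>, so \<open>x\<close> cannot leave the closed
  convex set \<open>X\<close> as long as \<open>\<nabla>\<psi>\<^sup>*\<close> takes its values in \<open>X\<close>. To make this precise, multiply by the
  integrating factor: if \<open>x' = (\<alpha>/t) (y - x)\<close>, then for every affine function \<open>z \<mapsto> a \<bullet> z - c\<close> the
  derivative of \<open>t\<^sup>\<alpha> (a \<bullet> x(t) - c)\<close> is \<open>\<alpha> t\<^sup>\<alpha>\<^sup>-\<^sup>1 (a \<bullet> y(t) - c)\<close>. If \<open>x(t\<^sub>1)\<close> were outside \<open>X\<close>, choose a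
  hyperplane that strictly separates it from \<open>X\<close>; as \<open>y\<close> stays in \<open>X\<close>, the function above is
  nondecreasing, positive at \<open>t\<^sub>0\<close> and negative at \<open>t\<^sub>1\<close>, which is impossible
  (\<open>averaging_flow_invariant\<close>).

  It remains to see that \<open>\<nabla>\<psi>\<^sup>*(u) \<in> X\<close> for all \<open>u\<close> (\<open>grad_conjugate_in_domain\<close>). The gradient should be
  the maximiser of \<open>u \<bullet> x - \<psi> x\<close> over \<open>X\<close>, that is, the minimiser of the tilted function
  \<open>\<psi> x - u \<bullet> x\<close>. Three facts give this. Subdifferentiability on the closed set \<open>X\<close> makes the epigraph
  closed. Cofiniteness then bounds the sublevel sets of every tilted function, because a ray in such a
  set lifts to a non-vertical ray in the epigraph; hence a minimiser exists. Strict convexity makes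
  the minimum sharp: away from the minimiser the tilted function grows at least linearly, so the
  minimiser depends continuously on \<open>u\<close>. Since \<open>\<psi>\<^sup>*(w) - \<psi>\<^sup>*(u)\<close> lies between \<open>(w - u) \<bullet> x\<^sub>u\<close> and
  \<open>(w - u) \<bullet> x\<^sub>w\<close>, where \<open>x\<^sub>u\<close> and \<open>x\<^sub>w\<close> are the minimisers for \<open>u\<close> and \<open>w\<close>, continuity of the minimiser is
  differentiability of \<open>\<psi>\<^sup>*\<close>.
\<close>

section \<open>Existence of minimisers of tilted functions\<close>

text \<open>
  The directions from \<open>x\<^sub>0\<close> to points of \<open>S\<close> tending to infinity accumulate on the unit sphere; a limit
  direction works, since \<open>S\<close> is closed and by convexity contains the segments towards those points.
\<close>

lemma unbounded_closed_convex_contains_ray: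
  fixes S :: "'a::euclidean_space set"
  assumes "closed S" "convex S" "\<not> bounded S" "x0 \<in> S"
  obtains d where "d \<noteq> 0" "\<And>s. s \<ge> 0 \<Longrightarrow> x0 + s *\<^sub>R d \<in> S"
proof -
  have "\<exists>y\<in>S. norm (y - x0) > real n" for n
  proof (rule ccontr)
    assume "\<not> (\<exists>y\<in>S. norm (y - x0) > real n)"
    then have "S \<subseteq> cball x0 (real n)"
      by (force simp: dist_norm norm_minus_commute)
    then show False
      using \<open>\<not> bounded S\<close> bounded_cball bounded_subset by blast
  qed
  then obtain y where y: "\<And>n. y n \<in> S" "\<And>n. norm (y n - x0) > real n"
    by metis
  have unit: "sgn (y n - x0) \<in> sphere 0 1" for n
    using y(2)[of n] by (auto simp: norm_sgn)
  obtain d r where d: "d \<in> sphere 0 1" "strict_mono r"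
    and lim: "((\<lambda>n. sgn (y n - x0)) \<circ> r) \<longlonglongrightarrow> d"
    using compact_sphere[of 0 1] unit unfolding compact_def by metis
  have "x0 + s *\<^sub>R d \<in> S" if "s \<ge> 0" for s
  proof (rule Lim_in_closed_set[OF \<open>closed S\<close>])
    show "(\<lambda>n. x0 + s *\<^sub>R sgn (y (r n) - x0)) \<longlonglongrightarrow> x0 + s *\<^sub>R d"
      using lim by (intro tendsto_intros) (simp add: o_def)
    obtain N :: nat where N: "s \<le> real N"
      using real_arch_simple by blast
    have "x0 + s *\<^sub>R sgn (y (r n) - x0) \<in> S" if "n \<ge> N" for n
    proof -
      have "real n \<le> real (r n)"
        using seq_suble[OF \<open>strict_mono r\<close>, of n] by simp
      then have gt: "s < norm (y (r n) - x0)"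
        using y(2)[of "r n"] N that by linarith
      define k where "k = s / norm (y (r n) - x0)"
      have "0 \<le> k" "k \<le> 1"
        using gt \<open>s \<ge> 0\<close> by (auto simp: k_def divide_le_eq)
      then have "(1 - k) *\<^sub>R x0 + k *\<^sub>R y (r n) \<in> S"
        using \<open>convex S\<close> \<open>x0 \<in> S\<close> y(1) by (intro convexD) auto
      moreover have "(1 - k) *\<^sub>R x0 + k *\<^sub>R y (r n) = x0 + s *\<^sub>R sgn (y (r n) - x0)"
        by (simp add: k_def sgn_div_norm divide_inverse algebra_simps)
      ultimately show ?thesis by simp
    qed
    then show "\<forall>\<^sub>F n in sequentially. x0 + s *\<^sub>R sgn (y (r n) - x0) \<in> S"
      by (auto simp: eventually_sequentially)
  qed auto
  moreover have "d \<noteq> 0"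
    using d(1) by auto
  ultimately show thesis
    using that by blast
qed

text \<open>
  A function with a subgradient at every point of \<open>X\<close> is the supremum over \<open>X\<close> of its affine minorants,
  so its epigraph is an intersection of closed sets.
\<close>

lemma closed_epigraph_if_subdifferentiable:
  fixes \<psi> :: "'a::real_inner \<Rightarrow> real"
  assumes "closed X" and subgrad: "\<And>x. x \<in> X \<Longrightarrow> subdifferential X \<psi> x \<noteq> {}"
  shows "closed (epigraph X \<psi>)"
proof -
  let ?H = "\<lambda>z g. {p. \<psi> z + inner g (fst p - z) \<le> snd p}"
  have "epigraph X \<psi> = (fst -` X) \<inter> (\<Inter>z\<in>X. \<Inter>g\<in>subdifferential X \<psi> z. ?H z g)"
  proof (intro equalityI subsetI)
    fix p assume "p \<in> epigraph X \<psi>"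
    then show "p \<in> (fst -` X) \<inter> (\<Inter>z\<in>X. \<Inter>g\<in>subdifferential X \<psi> z. ?H z g)"
      by (fastforce simp: epigraph_def subdifferential_def)
  next
    fix p assume p: "p \<in> (fst -` X) \<inter> (\<Inter>z\<in>X. \<Inter>g\<in>subdifferential X \<psi> z. ?H z g)"
    then obtain g where "g \<in> subdifferential X \<psi> (fst p)"
      using subgrad[of "fst p"] by auto
    with p have "p \<in> ?H (fst p) g" "fst p \<in> X"
      by blast+
    then show "p \<in> epigraph X \<psi>"
      by (simp add: epigraph_def)
  qed
  moreover have "closed (fst -` X :: ('a \<times> real) set)"
    by (intro closed_vimage assms continuous_intros)
  moreover have "closed (?H z g)" for z g
    by (intro closed_Collect_le continuous_intros)
  ultimately show ?thesis
    by (simp add: closed_INT closed_Int)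
qed

lemma closed_tilted_sublevel:
  fixes \<psi> :: "'a::real_inner \<Rightarrow> real"
  assumes "closed (epigraph X \<psi>)"
  shows "closed {x \<in> X. \<psi> x - inner u x \<le> c}"
proof -
  have "{x \<in> X. \<psi> x - inner u x \<le> c} = (\<lambda>x. (x, c + inner u x)) -` epigraph X \<psi>"
    by (auto simp: mem_epigraph)
  then show ?thesis
    using assms by (simp add: closed_vimage continuous_intros)
qed

text \<open>
  This is the extreme value theorem for lower semicontinuous functions: the sublevel sets at the
  values taken on \<open>K\<close> have the finite intersection property.
\<close>

lemma tilted_attains_inf_on_compact:
  fixes \<psi> :: "'a::real_inner \<Rightarrow> real"
  assumes "closed (epigraph X \<psi>)" "compact K" "K \<inter> X \<noteq> {}"
  shows "\<exists>m\<in>K \<inter> X. \<forall>y\<in>K \<inter> X. \<psi> m - inner u m \<le> \<psi> y - inner u y"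
proof -
  let ?h = "\<lambda>x. \<psi> x - inner u x"
  have "K \<inter> (\<Inter>z\<in>K \<inter> X. {x \<in> X. ?h x \<le> ?h z}) \<noteq> {}"
  proof (rule compact_imp_fip_image[OF \<open>compact K\<close>])
    fix F assume F: "finite F" "F \<subseteq> K \<inter> X"
    show "K \<inter> (\<Inter>z\<in>F. {x \<in> X. ?h x \<le> ?h z}) \<noteq> {}"
    proof (cases "F = {}")
      case False
      then obtain z where "z \<in> F" "\<And>y. y \<in> F \<Longrightarrow> ?h z \<le> ?h y"
        using arg_min_if_finite[of F ?h] F(1) by (metis not_le)
      then show ?thesis
        using F(2) by auto
    qed (use assms in auto)
  qed (use closed_tilted_sublevel[OF assms(1)] in auto)
  then obtain m where "m \<in> K" "m \<in> (\<Inter>z\<in>K \<inter> X. {x \<in> X. ?h x \<le> ?h z})"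
    by blast
  with assms(3) show ?thesis
    by auto
qed

text \<open>
  A ray in a sublevel set of the tilted function with direction \<open>d\<close> lifts to the ray in the epigraph
  with direction \<open>(d, u \<bullet> d)\<close>, which cofiniteness forbids.
\<close>

lemma bounded_tilted_sublevel:
  fixes \<psi> :: "'a::euclidean_space \<Rightarrow> real"
  assumes "closed (epigraph X \<psi>)" "cofinite_on X \<psi>"
  shows "bounded {x \<in> X. \<psi> x - inner u x \<le> c}"
proof (rule ccontr)
  let ?L = "{x \<in> X. \<psi> x - inner u x \<le> c}"
  assume unbounded: "\<not> bounded ?L"
  then obtain x0 where x0: "x0 \<in> ?L"
    using bounded_empty by (metis ex_in_conv)
  have \<psi>: "convex_on X \<psi>"
    using assms(2) by (simp add: cofinite_on_def)
  have "convex ?L"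
  proof (rule convexI)
    fix x y and s t :: real
    assume xy: "x \<in> ?L" "y \<in> ?L" and st: "0 \<le> s" "0 \<le> t" "s + t = 1"
    then have "x \<in> X" "y \<in> X" by auto
    then have "\<psi> (s *\<^sub>R x + t *\<^sub>R y) \<le> s * \<psi> x + t * \<psi> y"
      using \<psi> st unfolding convex_on_def by blast
    moreover have "s * (\<psi> x - inner u x) + t * (\<psi> y - inner u y) \<le> c"
      using xy by (intro convex_bound_le st) auto
    moreover have "s *\<^sub>R x + t *\<^sub>R y \<in> X"
      using \<psi> \<open>x \<in> X\<close> \<open>y \<in> X\<close> st unfolding convex_on_def by (blast intro: convexD)
    ultimately show "s *\<^sub>R x + t *\<^sub>R y \<in> ?L"
      by (simp add: inner_add_right algebra_simps)
  qed
  then obtain d where d: "d \<noteq> 0" "\<And>s. s \<ge> 0 \<Longrightarrow> x0 + s *\<^sub>R d \<in> ?L"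
    using unbounded_closed_convex_contains_ray[OF closed_tilted_sublevel[OF assms(1)] _ unbounded x0]
    by blast
  have "(x0, c + inner u x0) + s *\<^sub>R (d, inner u d) \<in> epigraph X \<psi>" if "s \<ge> 0" for s
    using d(2)[OF that] by (auto simp: mem_epigraph inner_add_right)
  then show False
    using assms(2) \<open>d \<noteq> 0\<close> unfolding cofinite_on_def by (metis fst_conv)
qed

lemma tilted_minimizer_exists:
  fixes \<psi> :: "'a::euclidean_space \<Rightarrow> real"
  assumes "closed (epigraph X \<psi>)" "cofinite_on X \<psi>" "X \<noteq> {}"
  obtains m where "m \<in> X" "\<And>y. y \<in> X \<Longrightarrow> \<psi> m - inner u m \<le> \<psi> y - inner u y"
proof -
  obtain z where z: "z \<in> X" using assms(3) by blast
  let ?L = "{x \<in> X. \<psi> x - inner u x \<le> \<psi> z - inner u z}"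
  have "compact ?L"
    using bounded_tilted_sublevel[OF assms(1,2)] closed_tilted_sublevel[OF assms(1)]
    by (simp add: compact_eq_bounded_closed)
  moreover have "?L \<inter> X \<noteq> {}"
    using z by auto
  ultimately obtain m
    where m: "m \<in> ?L \<inter> X" "\<forall>y\<in>?L \<inter> X. \<psi> m - inner u m \<le> \<psi> y - inner u y"
    using tilted_attains_inf_on_compact[OF assms(1), of ?L u] by meson
  have "\<psi> m - inner u m \<le> \<psi> y - inner u y" if "y \<in> X" for y
    using m that by (cases "y \<in> ?L \<inter> X") auto
  with m(1) that show thesis by blast
qed

section \<open>The gradient of the conjugate\<close>

text \<open>
  On the sphere of radius \<open>\<epsilon>\<close> about the minimiser the tilted function exceeds its minimum by some
  \<open>\<delta> > 0\<close>, by compactness and strict convexity; convexity along rays from the minimiser propagates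
  this excess linearly outwards.
\<close>

lemma tilted_minimizer_sharp:
  fixes \<psi> :: "'a::euclidean_space \<Rightarrow> real"
  assumes closed: "closed (epigraph X \<psi>)" and strict: "strictly_convex_on X \<psi>"
    and m: "m \<in> X" "\<And>y. y \<in> X \<Longrightarrow> \<psi> m - inner u m \<le> \<psi> y - inner u y"
    and "\<epsilon> > 0"
  obtains k where "k > 0"
    "\<And>y. y \<in> X \<Longrightarrow> norm (y - m) \<ge> \<epsilon> \<Longrightarrow> \<psi> y - inner u y \<ge> \<psi> m - inner u m + k * norm (y - m)"
proof -
  let ?h = "\<lambda>x. \<psi> x - inner u x"
  have "convex X"
    using strict by (simp add: strictly_convex_on_def)
  have strict_h: "?h (s *\<^sub>R x + t *\<^sub>R y) < s * ?h x + t * ?h y"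
    if "x \<in> X" "y \<in> X" "s > 0" "t > 0" "x \<noteq> y" "s + t = 1" for x y s t
  proof -
    have "\<psi> (s *\<^sub>R x + t *\<^sub>R y) < s * \<psi> x + t * \<psi> y"
      using strict that unfolding strictly_convex_on_def by blast
    then show ?thesis by (simp add: inner_add_right algebra_simps)
  qed
  obtain \<delta> where "\<delta> > 0" and \<delta>: "\<And>y. y \<in> sphere m \<epsilon> \<inter> X \<Longrightarrow> ?h y \<ge> ?h m + \<delta>"
  proof (cases "sphere m \<epsilon> \<inter> X = {}")
    case True
    then show ?thesis using that[of 1] by auto
  next
    case False
    then obtain p where p: "p \<in> sphere m \<epsilon> \<inter> X" "\<forall>y\<in>sphere m \<epsilon> \<inter> X. ?h p \<le> ?h y"
      using tilted_attains_inf_on_compact[OF closed compact_sphere, of m \<epsilon> u] by meson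
    have "p \<noteq> m" using p(1) \<open>\<epsilon> > 0\<close> by auto
    then have "?h ((1/2) *\<^sub>R p + (1/2) *\<^sub>R m) < (1/2) * ?h p + (1/2) * ?h m"
      using p(1) m(1) by (intro strict_h) auto
    moreover have "(1/2) *\<^sub>R p + (1/2) *\<^sub>R m \<in> X"
      using p(1) m(1) \<open>convex X\<close> by (intro convexD) auto
    ultimately have "?h m < (1/2) * ?h p + (1/2) * ?h m"
      by (rule le_less_trans[OF m(2), rotated])
    then have "?h m < ?h p"
      by (simp add: field_simps)
    then show ?thesis
      using that[of "?h p - ?h m"] p(2) by auto
  qed
  have "?h y \<ge> ?h m + \<delta> / \<epsilon> * norm (y - m)" if y: "y \<in> X" "norm (y - m) \<ge> \<epsilon>" for y
  proof -
    define s where "s = \<epsilon> / norm (y - m)"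
    have s: "s > 0" "s \<le> 1" and norm_pos: "norm (y - m) > 0"
      using y(2) \<open>\<epsilon> > 0\<close> by (auto simp: s_def divide_simps)
    let ?q = "s *\<^sub>R y + (1 - s) *\<^sub>R m"
    have "?q \<in> X"
      using s y(1) m(1) \<open>convex X\<close> by (intro convexD) auto
    moreover have "m - ?q = s *\<^sub>R (m - y)"
      by (simp add: algebra_simps)
    then have "norm (m - ?q) = \<epsilon>"
      using norm_pos \<open>\<epsilon> > 0\<close> by (simp add: s_def norm_minus_commute)
    ultimately have "?h m + \<delta> \<le> ?h ?q"
      by (intro \<delta>) (simp add: dist_norm)
    also have "?h ?q \<le> s * ?h y + (1 - s) * ?h m"
    proof (cases "s = 1")
      case False
      then show ?thesis
        using strict_h[of y m s "1 - s"] s y(1) m(1) norm_pos by force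
    qed simp
    finally have "\<delta> \<le> s * (?h y - ?h m)"
      by (simp add: algebra_simps)
    then have "\<delta> / s \<le> ?h y - ?h m"
      using s(1) by (simp add: divide_simps mult.commute)
    then show ?thesis
      by (simp add: s_def)
  qed
  moreover have "\<delta> / \<epsilon> > 0"
    using \<open>\<delta> > 0\<close> \<open>\<epsilon> > 0\<close> by simp
  ultimately show thesis
    using that by blast
qed

text \<open>
  Perturbing \<open>u\<close> to \<open>w\<close> changes the tilted function by \<open>(u - w) \<bullet> y\<close>, which cannot outweigh the linear
  growth of rate \<open>k\<close> once \<open>norm (w - u) < k\<close>.
\<close>

lemma tilted_minimizer_continuous:
  fixes \<psi> :: "'a::euclidean_space \<Rightarrow> real"
  assumes "closed (epigraph X \<psi>)" "strictly_convex_on X \<psi>"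
    and m: "m \<in> X" "\<And>y. y \<in> X \<Longrightarrow> \<psi> m - inner u m \<le> \<psi> y - inner u y"
    and "\<epsilon> > 0"
  obtains k where "k > 0"
    "\<And>w q. norm (w - u) < k \<Longrightarrow> q \<in> X \<Longrightarrow>
      (\<And>y. y \<in> X \<Longrightarrow> \<psi> q - inner w q \<le> \<psi> y - inner w y) \<Longrightarrow> norm (q - m) < \<epsilon>"
proof -
  obtain k where "k > 0" and k: "\<And>y. y \<in> X \<Longrightarrow> norm (y - m) \<ge> \<epsilon> \<Longrightarrow>
      \<psi> y - inner u y \<ge> \<psi> m - inner u m + k * norm (y - m)"
    using tilted_minimizer_sharp[OF assms] by blast
  have "norm (q - m) < \<epsilon>"
    if w: "norm (w - u) < k" and q: "q \<in> X" "\<And>y. y \<in> X \<Longrightarrow> \<psi> q - inner w q \<le> \<psi> y - inner w y" for w q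
  proof (rule ccontr)
    assume "\<not> norm (q - m) < \<epsilon>"
    then have far: "norm (q - m) \<ge> \<epsilon>" by simp
    have "k * norm (q - m) \<le> inner (w - u) (q - m)"
      using k[OF q(1) far] q(2)[OF m(1)] by (simp add: inner_diff_left inner_diff_right)
    also have "\<dots> \<le> norm (w - u) * norm (q - m)"
      by (rule norm_cauchy_schwarz)
    also have "\<dots> < k * norm (q - m)"
      using w far \<open>\<epsilon> > 0\<close> by (intro mult_strict_right_mono) auto
    finally show False by simp
  qed
  with \<open>k > 0\<close> that show thesis by blast
qed

lemma conjugate_eq_at_minimizer:
  assumes "m \<in> X" "\<And>y. y \<in> X \<Longrightarrow> \<psi> m - inner u m \<le> \<psi> y - inner u y"
  shows "conjugate X \<psi> u = ereal (inner u m - \<psi> m)"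
  unfolding conjugate_def
proof (rule antisym)
  show "(SUP x\<in>X. ereal (inner u x - \<psi> x)) \<le> ereal (inner u m - \<psi> m)"
    using assms(2) by (intro SUP_least) force
  show "ereal (inner u m - \<psi> m) \<le> (SUP x\<in>X. ereal (inner u x - \<psi> x))"
    using assms(1) by (intro SUP_upper)
qed

text \<open>
  Testing each of the two minimisers \<open>m\<close> (for \<open>u\<close>) and \<open>q\<close> (for \<open>w\<close>) in the other's problem bounds the
  linearisation error of \<open>\<psi>\<^sup>*\<close> by \<open>0\<close> from below and \<open>(w - u) \<bullet> (q - m)\<close> from above, and \<open>q\<close> is close to \<open>m\<close>.
\<close>

lemma conjugate_has_gradient_minimizer:
  fixes \<psi> :: "'a::euclidean_space \<Rightarrow> real"
  assumes closed: "closed (epigraph X \<psi>)" and strict: "strictly_convex_on X \<psi>"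
    and cofin: "cofinite_on X \<psi>"
    and m: "m \<in> X" "\<And>y. y \<in> X \<Longrightarrow> \<psi> m - inner u m \<le> \<psi> y - inner u y"
  shows "GDERIV (\<lambda>u. real_of_ereal (conjugate X \<psi> u)) u :> m"
  unfolding gderiv_def has_derivative_at_alt
proof (intro conjI allI impI)
  show "bounded_linear (\<lambda>h. inner h m)"
    by (rule bounded_linear_inner_left)
  fix \<epsilon> :: real assume "\<epsilon> > 0"
  then obtain k where "k > 0" and k: "\<And>w q. norm (w - u) < k \<Longrightarrow> q \<in> X \<Longrightarrow>
      (\<And>y. y \<in> X \<Longrightarrow> \<psi> q - inner w q \<le> \<psi> y - inner w y) \<Longrightarrow> norm (q - m) < \<epsilon>"
    using tilted_minimizer_continuous[OF closed strict m] by blast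
  let ?g = "\<lambda>u. real_of_ereal (conjugate X \<psi> u)"
  have "norm (?g w - ?g u - inner (w - u) m) \<le> \<epsilon> * norm (w - u)" if w: "norm (w - u) < k" for w
  proof -
    obtain q where q: "q \<in> X" "\<And>y. y \<in> X \<Longrightarrow> \<psi> q - inner w q \<le> \<psi> y - inner w y"
      using tilted_minimizer_exists[OF closed cofin, of w] m(1) by blast
    have val: "?g w = inner w q - \<psi> q" "?g u = inner u m - \<psi> m"
      using conjugate_eq_at_minimizer[of q X \<psi> w] conjugate_eq_at_minimizer[of m X \<psi> u] q m
      by simp_all
    have "0 \<le> ?g w - ?g u - inner (w - u) m"
      using q(2)[OF m(1)] by (simp add: val inner_diff_left)
    moreover have "?g w - ?g u - inner (w - u) m \<le> inner (w - u) (q - m)"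
      using m(2)[OF q(1)] by (simp add: val inner_diff_left inner_diff_right)
    moreover have "inner (w - u) (q - m) \<le> norm (w - u) * norm (q - m)"
      by (rule norm_cauchy_schwarz)
    moreover have "norm (w - u) * norm (q - m) \<le> norm (w - u) * \<epsilon>"
      using k[OF w q] by (intro mult_left_mono) auto
    ultimately show ?thesis
      by (simp add: mult.commute)
  qed
  with \<open>k > 0\<close> show "\<exists>d>0. \<forall>w. norm (w - u) < d \<longrightarrow>
      norm (?g w - ?g u - inner (w - u) m) \<le> \<epsilon> * norm (w - u)"
    by blast
qed

lemma grad_conjugate_in_domain:
  fixes \<psi> :: "'a::euclidean_space \<Rightarrow> real"
  assumes "closed X" "X \<noteq> {}" and ess: "essentially_strictly_convex X \<psi>" and "cofinite_on X \<psi>"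
  shows "grad_conjugate X \<psi> u \<in> X"
proof -
  have "convex X"
    using ess by (simp add: essentially_strictly_convex_def convex_on_def)
  then have strict: "strictly_convex_on X \<psi>" and "\<And>x. x \<in> X \<Longrightarrow> subdifferential X \<psi> x \<noteq> {}"
    using ess unfolding essentially_strictly_convex_def by blast+
  then have closed: "closed (epigraph X \<psi>)"
    using \<open>closed X\<close> closed_epigraph_if_subdifferentiable by blast
  obtain m where m: "m \<in> X" "\<And>y. y \<in> X \<Longrightarrow> \<psi> m - inner u m \<le> \<psi> y - inner u y"
    using tilted_minimizer_exists[OF closed assms(4,2)] by blast
  have "grad_conjugate X \<psi> u = m"
    unfolding grad_conjugate_def
    by (intro gradient_eq conjugate_has_gradient_minimizer closed strict assms(4) m)
  with m(1) show ?thesis by simp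
qed

section \<open>Invariance of the constraint set\<close>

text \<open>
  Each \<open>x t\<close> is a weighted average of \<open>x t0\<close> and of the earlier values of \<open>y\<close>: the derivative of
  \<open>t powr \<alpha> *\<^sub>R x t\<close> is a nonnegative multiple of \<open>y t\<close>. A functional that separates \<open>x t1\<close> from \<open>X\<close> turns
  this into the monotonicity of a real function.
\<close>

lemma averaging_flow_invariant:
  fixes x y :: "real \<Rightarrow> 'a::euclidean_space"
  assumes "closed X" "convex X" "t0 > 0" "\<alpha> \<ge> 0" "x t0 \<in> X"
    and y: "\<And>t. t \<ge> t0 \<Longrightarrow> y t \<in> X"
    and deriv: "\<And>t. t \<ge> t0 \<Longrightarrow>
      (x has_vector_derivative (\<alpha> / t) *\<^sub>R (y t - x t)) (at t within {t0..})"
    and "t1 \<ge> t0"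
  shows "x t1 \<in> X"
proof (rule ccontr)
  assume "x t1 \<notin> X"
  then obtain a c where sep: "inner a (x t1) < c" "\<And>z. z \<in> X \<Longrightarrow> inner a z > c"
    using separating_hyperplane_closed_point[OF \<open>convex X\<close> \<open>closed X\<close>] by blast
  let ?\<phi> = "\<lambda>t. t powr \<alpha> * (inner a (x t) - c)"
  let ?\<phi>' = "\<lambda>t. \<alpha> * t powr (\<alpha> - 1) * (inner a (y t) - c)"
  have "(?\<phi> has_real_derivative ?\<phi>' t) (at t within {t0..t1})" if "t \<in> {t0..t1}" for t
  proof -
    have "t > 0" using that \<open>t0 > 0\<close> by simp
    have "(x has_vector_derivative (\<alpha> / t) *\<^sub>R (y t - x t)) (at t within {t0..t1})"
      using deriv[of t] that by (auto intro: has_vector_derivative_within_subset)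
    then have "((\<lambda>t. inner a (x t)) has_vector_derivative inner a ((\<alpha> / t) *\<^sub>R (y t - x t)))
        (at t within {t0..t1})"
      by (rule bounded_linear.has_vector_derivative[OF bounded_linear_inner_right])
    then have inner_deriv: "((\<lambda>t. inner a (x t)) has_real_derivative \<alpha> / t * inner a (y t - x t))
        (at t within {t0..t1})"
      by (simp add: has_real_derivative_iff_has_vector_derivative)
    have powr_deriv: "((\<lambda>t. t powr \<alpha>) has_real_derivative \<alpha> * t powr (\<alpha> - 1)) (at t within {t0..t1})"
      using has_real_derivative_powr[OF \<open>t > 0\<close>] has_field_derivative_at_within by blast
    have "(?\<phi> has_real_derivative \<alpha> * t powr (\<alpha> - 1) * (inner a (x t) - c)
        + (\<alpha> / t * inner a (y t - x t)) * t powr \<alpha>) (at t within {t0..t1})"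
      using DERIV_mult'[OF powr_deriv DERIV_diff[OF inner_deriv DERIV_const[of c]]]
      by (simp add: algebra_simps)
    moreover have "t powr \<alpha> = t * t powr (\<alpha> - 1)"
      using \<open>t > 0\<close> by (simp add: powr_diff)
    then have "\<alpha> * t powr (\<alpha> - 1) * (inner a (x t) - c) + (\<alpha> / t * inner a (y t - x t)) * t powr \<alpha>
        = ?\<phi>' t"
      using \<open>t > 0\<close> by (simp add: inner_diff_right algebra_simps)
    ultimately show ?thesis by simp
  qed
  then obtain s where s: "s \<in> {t0..t1}" "?\<phi> t1 - ?\<phi> t0 = ?\<phi>' s * (t1 - t0)"
    using mvt_very_simple[OF \<open>t1 \<ge> t0\<close>, of ?\<phi> "\<lambda>t h. ?\<phi>' t * h"]
    by (auto simp: has_field_derivative_def)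
  have "?\<phi>' s \<ge> 0"
    using s(1) sep(2)[OF y[of s]] \<open>\<alpha> \<ge> 0\<close> by (intro mult_nonneg_nonneg) auto
  then have "?\<phi> t0 \<le> ?\<phi> t1"
    using s(2) \<open>t1 \<ge> t0\<close> by (metis diff_ge_0_iff_ge mult_nonneg_nonneg)
  moreover have "?\<phi> t0 > 0"
    using sep(2)[OF \<open>x t0 \<in> X\<close>] \<open>t0 > 0\<close> by simp
  moreover have "?\<phi> t1 < 0"
    using sep(1) \<open>t0 > 0\<close> \<open>t1 \<ge> t0\<close> by (simp add: mult_pos_neg)
  ultimately show False by linarith
qed

theorem lemma8:
  fixes X :: "(real^'n) set"
    and A :: "real^'n^'m"
    and b :: "real^'m"
    and f \<psi> :: "real^'n \<Rightarrow> real"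
    and t0 \<alpha> \<beta> :: real
    and x u :: "real \<Rightarrow> real^'n"
    and l v :: "real \<Rightarrow> real^'m"
  assumes "closed X" and "convex X"
    and "smooth_convex_near X f"
    and "proper_on X \<psi>" and "essentially_strictly_convex X \<psi>" and "cofinite_on X \<psi>"
    and "\<exists>z \<in> interior X. A *v z = b"
    and "\<exists>z. is_arg_min f (\<lambda>y. A *v y = b \<and> y \<in> X) z"
    and "t0 > 0" and "\<alpha> \<ge> 2" and "\<beta> > 0"
    and "x t0 \<in> X" and "grad_conjugate X \<psi> (u t0) = x t0"
    and "APDMD_solution X A b f \<psi> t0 \<alpha> \<beta> x u l v"
  shows "\<forall>t\<ge>t0. x t \<in> X"
proof (intro allI impI)
  fix t assume "t \<ge> t0"
  have "X \<noteq> {}"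
    using \<open>x t0 \<in> X\<close> by blast
  then have "grad_conjugate X \<psi> (u s) \<in> X" for s
    using assms grad_conjugate_in_domain by blast
  moreover have "(x has_vector_derivative (\<alpha> / s) *\<^sub>R (grad_conjugate X \<psi> (u s) - x s))
      (at s within {t0..})" if "s \<ge> t0" for s
    using assms(14) that by (simp add: APDMD_solution_def)
  moreover have "\<alpha> \<ge> 0"
    using \<open>\<alpha> \<ge> 2\<close> by simp
  ultimately show "x t \<in> X"
    using averaging_flow_invariant[of X t0 \<alpha> x "\<lambda>s. grad_conjugate X \<psi> (u s)" t]
      \<open>closed X\<close> \<open>convex X\<close> \<open>t0 > 0\<close> \<open>x t0 \<in> X\<close> \<open>t \<ge> t0\<close> by blast
qed

end
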